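(* Let $l$ be a complete distributive lattice, let $TS=(S,Act,\to,I,AP,L)$ be a (finite) multi-valued transition system over $l$ and let $P:(2^{AP})^{\omega}\to l$ be a safety property. Then $TS\models P$ if and only if $\mathrm{Traces}_{fin}(TS)\subseteq \mathrm{GPref}(P)$, i.e. $\mathrm{Traces}_{fin}(TS)(\theta)\le\mathrm{GPref}(P)(\theta)$ for all $\theta\in(2^{AP})^{*}$.
   Context: A multi-valued transition system (mv-TS) is $TS=(S,Act,\to,I,AP,L)$ with finite sets $S$ (states), $Act$ (actions), $AP$ (atomic propositions), a transition map $\eta:S\times Act\times S\to l$, an initial map $I:S\to l$ and a labeling $L:S\to 2^{AP}$. An infinite execution fragment is $\rho=s_0\alpha_1s_1\alpha_2\cdots$ with $s_i\in S,\alpha_i\in Act$; its truth value is $v(\rho)=I(s_0)\wedge\bigwedge_{i\ge0}\eta(s_i,\alpha_{i+1},s_{i+1})$. The trace function $\mathrm{Traces}(TS):(2^{AP})^{\omega}\to l$ is $\mathrm{Traces}(TS)(\sigma)=\bigvee\{v(\rho):\rho=s_0\alpha_1s_1\cdots \text{ with } L(s_0)L(s_1)\cdots=\sigma\}$ (empty join $=0$). The finite trace function is $\mathrm{Traces}_{fin}(TS)(\theta)=\bigvee\{\mathrm{Traces}(TS)(\theta\tau):\tau\in(2^{AP})^{\omega}\}$. For $P:(2^{AP})^{\omega}\to l$, $TS\models P$ means $\mathrm{Traces}(TS)(\sigma)\le P(\sigma)$ for all $\sigma$. $\mathrm{Pref}(\sigma)$ is the set of finite prefixes of $\sigma$; $\mathrm{GPref}(P)(\theta)=\bigvee\{P(\theta\tau):\tau\in(2^{AP})^{\omega}\}$;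 $P$ is a safety property if $\bigwedge\{\mathrm{GPref}(P)(\theta):\theta\in\mathrm{Pref}(\sigma)\}\le P(\sigma)$ for all $\sigma\in(2^{AP})^{\omega}$. *)

theory Defs
  imports Main "HOL-Library.Stream"
begin

text \<open>
  The sets \<open>S\<close>, \<open>Act\<close> and \<open>AP\<close> are explicit carriers inside types. The maps are total on the
  types, but only their values on the carriers are ever used. Infinite words over \<open>2\<^sup>A\<^sup>P\<close> are the
  elements of \<open>streams (Pow AP)\<close>, finite words those of \<open>lists (Pow AP)\<close>.
\<close>

record ('s, 'act, 'ap, 'l) mv_ts =
  states :: "'s set"
  actions :: "'act set"
  trans_map :: "'s \<Rightarrow> 'act \<Rightarrow> 's \<Rightarrow> 'l"
  init_map :: "'s \<Rightarrow> 'l"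
  atoms :: "'ap set"
  labeling :: "'s \<Rightarrow> 'ap set"

definition wf_mv_ts :: "('s, 'act, 'ap, 'l) mv_ts \<Rightarrow> bool" where
  "wf_mv_ts TS \<longleftrightarrow>
     finite (states TS) \<and> finite (actions TS) \<and> finite (atoms TS) \<and>
     (\<forall>s \<in> states TS. labeling TS s \<subseteq> atoms TS)"

text \<open>
  A fragment \<open>s\<^sub>0 \<alpha>\<^sub>1 s\<^sub>1 \<alpha>\<^sub>2 \<dots>\<close> is the pair of its state stream and its action stream. Actions are
  numbered from 1 and streams from 0, so the action between \<open>ss !! i\<close> and \<open>ss !! Suc i\<close> is
  \<open>as !! i\<close>.
\<close>

definition fragments :: "('s, 'act, 'ap, 'l) mv_ts \<Rightarrow> ('s stream \<times> 'act stream) set" where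
  "fragments TS = streams (states TS) \<times> streams (actions TS)"

definition truth_value ::
    "('s, 'act, 'ap, 'l :: complete_lattice) mv_ts \<Rightarrow> 's stream \<times> 'act stream \<Rightarrow> 'l" where
  "truth_value TS = (\<lambda>(ss, as).
     inf (init_map TS (ss !! 0)) (INF i. trans_map TS (ss !! i) (as !! i) (ss !! Suc i)))"

definition fragment_trace ::
    "('s, 'act, 'ap, 'l) mv_ts \<Rightarrow> 's stream \<times> 'act stream \<Rightarrow> 'ap set stream" where
  "fragment_trace TS = (\<lambda>(ss, as). smap (labeling TS) ss)"

definition Traces ::
    "('s, 'act, 'ap, 'l :: complete_lattice) mv_ts \<Rightarrow> 'ap set stream \<Rightarrow> 'l" where
  "Traces TS \<sigma> = Sup {truth_value TS \<rho> | \<rho>. \<rho> \<in> fragments TS \<and> fragment_trace TS \<rho> = \<sigma>}"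

definition Traces_fin ::
    "('s, 'act, 'ap, 'l :: complete_lattice) mv_ts \<Rightarrow> 'ap set list \<Rightarrow> 'l" where
  "Traces_fin TS \<theta> = Sup {Traces TS (\<theta> @- \<tau>) | \<tau>. \<tau> \<in> streams (Pow (atoms TS))}"

definition satisfies ::
    "('s, 'act, 'ap, 'l :: complete_lattice) mv_ts \<Rightarrow> ('ap set stream \<Rightarrow> 'l) \<Rightarrow> bool" where
  "satisfies TS P \<longleftrightarrow> (\<forall>\<sigma> \<in> streams (Pow (atoms TS)). Traces TS \<sigma> \<le> P \<sigma>)"

definition Pref :: "'b stream \<Rightarrow> 'b list set" where
  "Pref \<sigma> = {\<theta>. \<exists>\<tau>. \<sigma> = \<theta> @- \<tau>}"

definition GPref ::
    "'ap set \<Rightarrow> ('ap set stream \<Rightarrow> 'l :: complete_lattice) \<Rightarrow> 'ap set list \<Rightarrow> 'l" where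
  "GPref AP P \<theta> = Sup {P (\<theta> @- \<tau>) | \<tau>. \<tau> \<in> streams (Pow AP)}"

definition safety_property ::
    "'ap set \<Rightarrow> ('ap set stream \<Rightarrow> 'l :: complete_lattice) \<Rightarrow> bool" where
  "safety_property AP P \<longleftrightarrow>
     (\<forall>\<sigma> \<in> streams (Pow AP). Inf {GPref AP P \<theta> | \<theta>. \<theta> \<in> Pref \<sigma>} \<le> P \<sigma>)"

end

theory Submission
  imports Defs
begin

text \<open>\<open>Traces_fin TS\<close> and \<open>GPref (atoms TS) P\<close> arise from
  \<open>Traces TS\<close> and \<open>P\<close> by the same monotone operation: the join over all
  infinite extensions of a finite word. Hence a pointwise bound on infinite words passes to finite
  words (\<open>Traces_fin_le_GPref\<close>). Conversely, \<open>Traces TS \<sigma>\<close> is one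
  of the joinands at every prefix of \<sigma> (\<open>Traces_le_Traces_fin\<close>), so it is a
  lower bound of the values of \<open>GPref\<close> on all prefixes; safety puts the meet of these
  values below \<open>P \<sigma>\<close>.\<close>

lemma streams_shift_iff: "\<theta> @- \<tau> \<in> streams A \<longleftrightarrow> \<theta> \<in> lists A \<and> \<tau> \<in> streams A"
  by (induction \<theta>) (auto elim: streams.cases)

lemma Traces_le_Traces_fin:
  assumes "\<tau> \<in> streams (Pow (atoms TS))"
  shows "Traces TS (\<theta> @- \<tau>) \<le> Traces_fin TS \<theta>"
  unfolding Traces_fin_def using assms by (auto intro!: Sup_upper)

text \<open>The same \<tau> indexes both joins, so they compare joinand by joinand; \<theta> is over
  the alphabet so that satisfaction applies to \<open>\<theta> @- \<tau>\<close>.\<close>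

lemma Traces_fin_le_GPref:
  assumes "satisfies TS P" and "\<theta> \<in> lists (Pow (atoms TS))"
  shows "Traces_fin TS \<theta> \<le> GPref (atoms TS) P \<theta>"
proof -
  have "Traces TS (\<theta> @- \<tau>) \<le> P (\<theta> @- \<tau>)" if "\<tau> \<in> streams (Pow (atoms TS))" for \<tau>
    using assms that by (simp add: satisfies_def streams_shift_iff)
  then show ?thesis
    unfolding Traces_fin_def GPref_def by (intro Sup_mono) blast
qed

theorem theorem1:
  fixes TS :: "('s, 'act, 'ap, 'l :: {complete_lattice, distrib_lattice}) mv_ts"
    and P :: "'ap set stream \<Rightarrow> 'l"
  assumes "wf_mv_ts TS"
    and "safety_property (atoms TS) P"
  shows "satisfies TS P \<longleftrightarrow>
    (\<forall>\<theta> \<in> lists (Pow (atoms TS)). Traces_fin TS \<theta> \<le> GPref (atoms TS) P \<theta>)"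
proof
  assume "satisfies TS P"
  then show "\<forall>\<theta> \<in> lists (Pow (atoms TS)). Traces_fin TS \<theta> \<le> GPref (atoms TS) P \<theta>"
    by (blast intro: Traces_fin_le_GPref)
next
  assume fin: "\<forall>\<theta> \<in> lists (Pow (atoms TS)). Traces_fin TS \<theta> \<le> GPref (atoms TS) P \<theta>"
  show "satisfies TS P"
    unfolding satisfies_def
  proof
    fix \<sigma> assume \<sigma>: "\<sigma> \<in> streams (Pow (atoms TS))"
    have "Traces TS \<sigma> \<le> GPref (atoms TS) P \<theta>" if prefix: "\<theta> \<in> Pref \<sigma>" for \<theta>
    proof -
      obtain \<tau> where \<tau>: "\<sigma> = \<theta> @- \<tau>"
        using prefix by (auto simp: Pref_def)
      \<comment> \<open>\<open>Pref\<close> does not constrain letters; that \<theta> and \<tau> are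
        words over the alphabet is inherited from \<sigma>.\<close>
      have \<theta>: "\<theta> \<in> lists (Pow (atoms TS))" and "\<tau> \<in> streams (Pow (atoms TS))"
        using \<sigma> unfolding \<tau> streams_shift_iff by blast+
      then have "Traces TS \<sigma> \<le> Traces_fin TS \<theta>"
        unfolding \<tau> by (intro Traces_le_Traces_fin)
      also have "\<dots> \<le> GPref (atoms TS) P \<theta>"
        using fin \<theta> by (rule bspec)
      finally show ?thesis .
    qed
    then have "Traces TS \<sigma> \<le> Inf {GPref (atoms TS) P \<theta> | \<theta>. \<theta> \<in> Pref \<sigma>}"
      by (blast intro: Inf_greatest)
    \<comment> \<open>The meet over prefixes always lies above \<open>P \<sigma>\<close>; safety
      supplies the reverse inequality, returning from finite words to \<sigma>.\<close>
    also have "\<dots> \<le> P \<sigma>"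
      using assms(2) \<sigma> by (simp add: safety_property_def)
    finally show "Traces TS \<sigma> \<le> P \<sigma>" .
  qed
qed

end
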